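(* There exists a constant $c>1$ such that, for $w$ chosen uniformly at random from $S_n$, the expected number of leaves of the transition tree satisfies $\mathbb{E}(\#\mathcal{L}(w))=\Omega(c^n)$ as $n\to\infty$.
   Context: For $w\in S_n$, the Rothe diagram is $D(w)=\{(i,j)\in\{1,\dots,n\}^2: j<w(i),\ i<w^{-1}(j)\}$ (matrix coordinates: $i$ is the row, $j$ the column). Boxes sharing an edge are adjacent; the dominant component is the connected component of $D(w)$ containing $(1,1)$, if $(1,1)\in D(w)$. The essential set is $\{(i,j)\in D(w): (i+1,j)\notin D(w),\ (i,j+1)\notin D(w)\}$. The accessible box is, among the essential set boxes not in the dominant component, the one in the largest row, and among those the one in the largest column. A permutation $w$ is vexillary if it avoids the pattern $2143$, i.e. there are no $i_1<i_2<i_3<i_4$ with $w(i_2)<w(i_1)<w(i_4)<w(i_3)$. The transition tree $\mathcal{T}(w)$ is the rooted tree with root labelled $w$ defined recursively: if $w$ is vexillary, the root is a leaf. Otherwise let $(x,y)$ be the accessible box, $x'=w^{-1}(y)$ and $y'=w(x)$. A pivot is an index $c<x$ with $w(c)<y$ such that there is no $c'$ with $c<c'<x$ and $w(c)<w(c')<y$. For each pivot $c$ the root has a child, which is the root of $\mathcal{T}(w^{(c)})$, where $w^{(c)}$ agrees with $w$ outside positions $c,x,x'$ and $w^{(c)}(c)=y$, $w^{(c)}(x)=w(c)$, $w^{(c)}(x')=y'$. $\mathcal{L}(w)$ denotes the collection of leaves of $\mathcal{T}(w)$ (labelled by vexillary permutations, with multiplicity), so $\#\mathcal{L}(w)$ is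 the number of leaves. *)

theory Defs
  imports
    "HOL-Probability.Probability_Mass_Function"
    "HOL-Combinatorics.Permutations"
    "HOL-Library.Landau_Symbols"
    "HOL-Library.Multiset"
begin

text \<open>
  An element of \<open>S_n\<close> is a function \<open>w :: nat \<Rightarrow> nat\<close> with \<open>w permutes {1..n}\<close>. A box \<open>(i, j)\<close> is
  in row \<open>i\<close> and column \<open>j\<close>.
\<close>

definition rothe_diagram :: "nat \<Rightarrow> (nat \<Rightarrow> nat) \<Rightarrow> (nat \<times> nat) set" where
  "rothe_diagram n w = {(i, j) \<in> {1..n} \<times> {1..n}. j < w i \<and> i < inv w j}"

definition adjacent :: "nat \<times> nat \<Rightarrow> nat \<times> nat \<Rightarrow> bool" where
  "adjacent p q \<longleftrightarrow>
     (fst p = fst q \<and> (snd q = Suc (snd p) \<or> snd p = Suc (snd q))) \<or>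
     (snd p = snd q \<and> (fst q = Suc (fst p) \<or> fst p = Suc (fst q)))"

definition dominant_component :: "nat \<Rightarrow> (nat \<Rightarrow> nat) \<Rightarrow> (nat \<times> nat) set" where
  "dominant_component n w =
     {b. (1, 1) \<in> rothe_diagram n w \<and>
         ((1, 1), b) \<in> {(p, q) \<in> rothe_diagram n w \<times> rothe_diagram n w. adjacent p q}\<^sup>*}"

definition essential_set :: "nat \<Rightarrow> (nat \<Rightarrow> nat) \<Rightarrow> (nat \<times> nat) set" where
  "essential_set n w = {(i, j) \<in> rothe_diagram n w.
     (i + 1, j) \<notin> rothe_diagram n w \<and> (i, j + 1) \<notin> rothe_diagram n w}"

definition is_accessible_box :: "nat \<Rightarrow> (nat \<Rightarrow> nat) \<Rightarrow> nat \<times> nat \<Rightarrow> bool" where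
  "is_accessible_box n w b \<longleftrightarrow>
     b \<in> essential_set n w - dominant_component n w \<and>
     (\<forall>b' \<in> essential_set n w - dominant_component n w.
        fst b' < fst b \<or> (fst b' = fst b \<and> snd b' \<le> snd b))"

text \<open>
  Only meaningful if the essential set is not contained in the dominant component; by
  \<open>accessible_box_nonvexillary\<close> below, this is so for every non-vexillary permutation.
\<close>

definition accessible_box :: "nat \<Rightarrow> (nat \<Rightarrow> nat) \<Rightarrow> nat \<times> nat" where
  "accessible_box n w = (THE b. is_accessible_box n w b)"

definition vexillary :: "nat \<Rightarrow> (nat \<Rightarrow> nat) \<Rightarrow> bool" where
  "vexillary n w \<longleftrightarrow>
     \<not> (\<exists>i1 i2 i3 i4. 1 \<le> i1 \<and> i1 < i2 \<and> i2 < i3 \<and> i3 < i4 \<and> i4 \<le> n \<and>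
          w i2 < w i1 \<and> w i1 < w i4 \<and> w i4 < w i3)"

definition pivots :: "(nat \<Rightarrow> nat) \<Rightarrow> nat \<times> nat \<Rightarrow> nat set" where
  "pivots w = (\<lambda>(x, y). {c. 1 \<le> c \<and> c < x \<and> w c < y \<and>
     \<not> (\<exists>c'. c < c' \<and> c' < x \<and> w c < w c' \<and> w c' < y)})"

definition transition :: "(nat \<Rightarrow> nat) \<Rightarrow> nat \<times> nat \<Rightarrow> nat \<Rightarrow> (nat \<Rightarrow> nat)" where
  "transition w = (\<lambda>(x, y) c. w(c := y, x := w c, inv w y := w x))"

datatype 'a rooted_tree = Node 'a "'a rooted_tree multiset"

primrec leaves :: "'a rooted_tree \<Rightarrow> 'a multiset" where
  "leaves (Node a ts) = (if ts = {#} then {#a#} else \<Sum>\<^sub># (image_mset leaves ts))"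

lemma rothe_diagram_subset: "rothe_diagram n w \<subseteq> {1..n} \<times> {1..n}"
  by (auto simp: rothe_diagram_def)

lemma finite_rothe_diagram: "finite (rothe_diagram n w)"
  by (rule finite_subset[OF rothe_diagram_subset]) simp

lemma dominant_component_no_NW:
  assumes w: "w permutes {1..n}" and b: "b \<in> dominant_component n w"
    and c: "1 \<le> c" "c \<le> fst b" "w c \<le> snd b"
  shows False
proof -
  have inj: "inv w (w i) = i" for i
    using permutes_inj[OF w] by simp
  have "((1, 1), b) \<in> {(p, q) \<in> rothe_diagram n w \<times> rothe_diagram n w. adjacent p q}\<^sup>*"
    and "(1, 1) \<in> rothe_diagram n w"
    using b by (auto simp: dominant_component_def)
  then have "\<forall>c. 1 \<le> c \<and> c \<le> fst b \<longrightarrow> snd b < w c"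
  proof (induction rule: rtrancl_induct)
    case base
    then show ?case by (auto simp: rothe_diagram_def le_Suc_eq)
  next
    case (step p q)
    obtain i j where q: "q = (i, j)" by force
    have ij: "1 \<le> i" "j < w i" "i < inv w j"
      using step.hyps q by (auto simp: rothe_diagram_def)
    have *: "w d \<noteq> j" if "d \<le> i" for d
      using ij(3) inj[of d] that by auto
    from step have IH: "\<And>c. 1 \<le> c \<Longrightarrow> c \<le> fst p \<Longrightarrow> snd p < w c" and adj: "adjacent p q"
      by auto
    show ?case
    proof (intro allI impI)
      fix d assume d: "1 \<le> d \<and> d \<le> fst q"
      show "snd q < w d"
      proof (cases "d = i")
        case True
        then show ?thesis using ij q by simp
      next
        case False
        with d q have "d < i" by simp
        then have "d \<le> fst p" using adj q by (auto simp: adjacent_def)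
        then have "snd p < w d" using IH d by blast
        moreover have "w d \<noteq> j" using * \<open>d < i\<close> by simp
        ultimately show ?thesis using adj q by (auto simp: adjacent_def)
      qed
    qed
  qed
  then show False using c by force
qed

lemma is_accessible_box_unique:
  "is_accessible_box n w b \<Longrightarrow> is_accessible_box n w b' \<Longrightarrow> b = b'"
  unfolding is_accessible_box_def by (metis less_asym' order_antisym_conv prod.expand)

lemma accessible_box_nonvexillary:
  assumes w: "w permutes {1..n}" and nv: "\<not> vexillary n w"
  shows "is_accessible_box n w (accessible_box n w)"
proof -
  let ?D = "rothe_diagram n w" and ?A = "essential_set n w - dominant_component n w"
  have inv_w: "inv w (w i) = i" for i
    using permutes_inj[OF w] by simp
  obtain i1 i2 i3 i4 where i: "1 \<le> i1" "i1 < i2" "i2 < i3" "i3 < i4" "i4 \<le> n"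
      "w i2 < w i1" "w i1 < w i4" "w i4 < w i3"
    using nv by (auto simp: vexillary_def)
  define P where "P = {b \<in> ?D. i1 \<le> fst b \<and> w i1 \<le> snd b}"
  have "w i4 \<in> {1..n}" using permutes_in_image[OF w, of i4] i by auto
  then have "(i3, w i4) \<in> P"
    using i by (auto simp: P_def rothe_diagram_def inv_w)
  moreover have "finite P" by (simp add: P_def finite_rothe_diagram)
  ultimately obtain b where b: "b \<in> P" "\<And>b'. b' \<in> P \<Longrightarrow> fst b' + snd b' \<le> fst b + snd b"
    using Max_in[of "(\<lambda>b. fst b + snd b) ` P"] Max_ge[of "(\<lambda>b. fst b + snd b) ` P"]
    by (smt (verit) empty_is_image equals0D finite_imageI image_iff)
  have "b \<in> essential_set n w"
    using b(1) b(2)[of "(fst b + 1, snd b)"] b(2)[of "(fst b, snd b + 1)"]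
    by (auto simp: essential_set_def P_def)
  moreover have "b \<notin> dominant_component n w"
    using dominant_component_no_NW[OF w, of b i1] b(1) i by (auto simp: P_def)
  ultimately have ne: "?A \<noteq> {}" by blast
  have fin: "finite ?A"
    by (rule finite_subset[OF _ finite_rothe_diagram[of n w]]) (auto simp: essential_set_def)
  define x where "x = Max (fst ` ?A)"
  define y where "y = Max {j. (x, j) \<in> ?A}"
  have "x \<in> fst ` ?A" unfolding x_def using ne fin by (intro Max_in) auto
  then have "{j. (x, j) \<in> ?A} \<noteq> {}" by force
  moreover have finy: "finite {j. (x, j) \<in> ?A}"
    by (rule finite_subset[of _ "snd ` ?A"]) (use fin in force)+
  ultimately have "(x, y) \<in> ?A" using Max_in[of "{j. (x, j) \<in> ?A}"] by (simp add: y_def)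
  moreover have "fst b' < x \<or> fst b' = x \<and> snd b' \<le> y" if "b' \<in> ?A" for b'
  proof -
    have "fst b' \<le> x" unfolding x_def using fin that by (intro Max_ge) auto
    moreover have "snd b' \<le> y" if "fst b' = x"
      unfolding y_def using \<open>b' \<in> ?A\<close> that finy by (intro Max_ge) (auto simp: prod_eq_iff)
    ultimately show ?thesis by linarith
  qed
  ultimately have "is_accessible_box n w (x, y)" by (auto simp: is_accessible_box_def)
  then show ?thesis
    unfolding accessible_box_def by (rule theI) (use \<open>is_accessible_box n w (x, y)\<close> is_accessible_box_unique in blast)
qed

text \<open>A transition step increases the permutation lexicographically; hence the recursion ends.\<close>

definition lex_less :: "(nat \<Rightarrow> nat) \<Rightarrow> (nat \<Rightarrow> nat) \<Rightarrow> bool" where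
  "lex_less u v \<longleftrightarrow> (\<exists>c. (\<forall>i<c. u i = v i) \<and> u c < v c)"

lemma lex_less_trans: "lex_less u v \<Longrightarrow> lex_less v w \<Longrightarrow> lex_less u w"
proof -
  assume "lex_less u v" "lex_less v w"
  then obtain c d where c: "\<forall>i<c. u i = v i" "u c < v c" and d: "\<forall>i<d. v i = w i" "v d < w d"
    by (auto simp: lex_less_def)
  have "(\<forall>i < min c d. u i = w i) \<and> u (min c d) < w (min c d)"
    using c d by (cases c d rule: linorder_cases) (auto simp: min_def)
  then show ?thesis unfolding lex_less_def by blast
qed

lemma
  assumes w: "w permutes {1..n}" and nv: "\<not> vexillary n w"
    and c: "c \<in> pivots w (accessible_box n w)"
  shows transition_permutes: "transition w (accessible_box n w) c permutes {1..n}"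
    and lex_less_transition: "lex_less w (transition w (accessible_box n w) c)"
proof -
  obtain x y where b: "accessible_box n w = (x, y)" by force
  define x' where "x' = inv w y"
  have "(x, y) \<in> rothe_diagram n w"
    using accessible_box_nonvexillary[OF w nv] b
    by (auto simp: is_accessible_box_def essential_set_def)
  then have xy: "x \<in> {1..n}" "y \<in> {1..n}" "x < x'" by (auto simp: rothe_diagram_def x'_def)
  have wx': "w x' = y" using permutes_inverses(1)[OF w] by (simp add: x'_def)
  have x': "x' \<in> {1..n}"
    using xy permutes_in_image[OF permutes_inv[OF w], of y] by (auto simp: x'_def)
  have c': "1 \<le> c" "c < x" "w c < y" using c b by (auto simp: pivots_def)
  have eq: "transition w (accessible_box n w) c = w(c := y, x := w c, x' := w x)"
    by (simp add: transition_def b x'_def)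
  have "w(c := y, x := w c, x' := w x) = w \<circ> (Transposition.transpose x x' \<circ> Transposition.transpose c x)"
    using c' xy wx' by (auto simp: fun_eq_iff Transposition.transpose_def)
  moreover have "w \<circ> (Transposition.transpose x x' \<circ> Transposition.transpose c x) permutes {1..n}"
    using c' xy x' w by (intro permutes_compose permutes_swap_id) auto
  ultimately show "transition w (accessible_box n w) c permutes {1..n}" by (simp add: eq)
  show "lex_less w (transition w (accessible_box n w) c)"
    unfolding eq lex_less_def using c' xy by (intro exI[of _ c]) auto
qed

lemma finite_pivots: "finite (pivots w b)"
  by (rule finite_subset[of _ "{..<fst b}"]) (auto simp: pivots_def split: prod.splits)

text \<open>
  The value on functions outside \<open>S_n\<close> is a dummy.
\<close>

function transition_tree :: "nat \<Rightarrow> (nat \<Rightarrow> nat) \<Rightarrow> (nat \<Rightarrow> nat) rooted_tree" where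
  "transition_tree n w =
     (if \<not> w permutes {1..n} \<or> vexillary n w then Node w {#}
      else Node w (image_mset (\<lambda>c. transition_tree n (transition w (accessible_box n w) c))
                              (mset_set (pivots w (accessible_box n w)))))"
  by pat_completeness auto
termination
proof (relation "Wellfounded.measure (\<lambda>(n, w). card {u. u permutes {1..n} \<and> lex_less w u})", goal_cases)
  case (2 n w c)
  define v where "v = transition w (accessible_box n w) c"
  from 2 have v: "v permutes {1..n}" "lex_less w v"
    using transition_permutes[of w n c] lex_less_transition[of w n c]
    by (auto simp: v_def finite_pivots)
  have "\<not> lex_less v v" by (simp add: lex_less_def)
  then have "{u. u permutes {1..n} \<and> lex_less v u} \<subset> {u. u permutes {1..n} \<and> lex_less w u}"
    using v lex_less_trans by blast
  moreover have "finite {u. u permutes {1..n} \<and> lex_less w u}"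
    by (rule finite_subset[OF _ finite_permutations[of "{1..n}"]]) auto
  ultimately show ?case by (simp add: psubset_card_mono v_def)
qed simp

declare transition_tree.simps [simp del]

lemma no_NW_dominant_component:
  assumes w: "w permutes {1..n}" and b: "(x, y) \<in> rothe_diagram n w"
    and no: "\<And>c. 1 \<le> c \<Longrightarrow> c \<le> x \<Longrightarrow> y < w c"
  shows "(x, y) \<in> dominant_component n w"
proof -
  let ?D = "rothe_diagram n w"
  let ?R = "{(p, q) \<in> ?D \<times> ?D. adjacent p q}"
  have xy: "1 \<le> x" "x \<le> n" "1 \<le> y" "y \<le> n" using b by (auto simp: rothe_diagram_def)
  have D: "(i, j) \<in> ?D" if ij: "1 \<le> i" "i \<le> x" "1 \<le> j" "j \<le> y" for i j
  proof -
    have "w (inv w j) = j" using permutes_inverses(1)[OF w] by simp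
    moreover have "inv w j \<in> {1..n}"
      using permutes_in_image[OF permutes_inv[OF w], of j] ij xy by auto
    ultimately have "\<not> inv w j \<le> x" using no[of "inv w j"] ij by auto
    then show ?thesis using no[of i] ij xy by (auto simp: rothe_diagram_def)
  qed
  have row: "((1, 1), (i, 1)) \<in> ?R\<^sup>*" if "1 \<le> i" "i \<le> x" for i
    using that
  proof (induction i rule: dec_induct)
    case (step i)
    have "((i, 1), (Suc i, 1)) \<in> ?R" using step D xy by (auto simp: adjacent_def)
    with step show ?case by (meson Suc_leD rtrancl.rtrancl_into_rtrancl)
  qed simp
  have "((1, 1), (x, j)) \<in> ?R\<^sup>*" if "1 \<le> j" "j \<le> y" for j
    using that
  proof (induction j rule: dec_induct)
    case base
    then show ?case using row xy by simp
  next
    case (step j)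
    have "((x, j), (x, Suc j)) \<in> ?R" using step D xy by (auto simp: adjacent_def)
    with step show ?case by (meson Suc_leD rtrancl.rtrancl_into_rtrancl)
  qed
  then show ?thesis using xy D[of 1 1] by (simp add: dominant_component_def)
qed

lemma pivots_nonempty:
  assumes w: "w permutes {1..n}" and nv: "\<not> vexillary n w"
  shows "pivots w (accessible_box n w) \<noteq> {}"
proof -
  obtain x y where b: "accessible_box n w = (x, y)" by force
  have acc: "(x, y) \<in> rothe_diagram n w" "(x, y) \<notin> dominant_component n w"
    using accessible_box_nonvexillary[OF w nv] b
    by (auto simp: is_accessible_box_def essential_set_def)
  then obtain c where c: "1 \<le> c" "c \<le> x" "w c \<le> y"
    using no_NW_dominant_component[OF w acc(1)] by (meson not_le)
  have "w c \<noteq> y" using acc(1) c permutes_inj[OF w] by (auto simp: rothe_diagram_def)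
  moreover have "c \<noteq> x" using acc(1) c by (auto simp: rothe_diagram_def)
  ultimately have "c \<in> {c. 1 \<le> c \<and> c < x \<and> w c < y}" using c by auto
  moreover have "finite {c. 1 \<le> c \<and> c < x \<and> w c < y}" by simp
  ultimately have "Max (w ` {c. 1 \<le> c \<and> c < x \<and> w c < y}) \<in> w ` {c. 1 \<le> c \<and> c < x \<and> w c < y}"
    by (intro Max_in) auto
  then obtain d where d: "1 \<le> d" "d < x" "w d < y"
      "w d = Max (w ` {c. 1 \<le> c \<and> c < x \<and> w c < y})"
    by auto
  have max: "w e \<le> w d" if "1 \<le> e" "e < x" "w e < y" for e
    unfolding d(4) using that by (intro Max_ge) auto
  have "d \<in> pivots w (x, y)"
    unfolding pivots_def using d(1-3) max
    by auto (metis leD le_trans less_imp_le_nat)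
  then show ?thesis by (auto simp: b)
qed

text \<open>Hence the leaves are exactly the nodes at which the recursion stops.\<close>

lemma leaves_vexillary:
  assumes "w permutes {1..n}" and "v \<in># leaves (transition_tree n w)"
  shows "v permutes {1..n} \<and> vexillary n v"
  using assms
proof (induction n w rule: transition_tree.induct)
  case (1 n w)
  show ?case
  proof (cases "vexillary n w")
    case True
    then show ?thesis using 1(2,3) by (simp add: transition_tree.simps[of n w])
  next
    case False
    let ?P = "pivots w (accessible_box n w)"
    have "mset_set ?P \<noteq> {#}"
      using pivots_nonempty[OF 1(2) False] finite_pivots by (simp add: mset_set_empty_iff)
    then obtain c where c: "c \<in> ?P"
        "v \<in># leaves (transition_tree n (transition w (accessible_box n w) c))"
      using 1(2,3) False by (auto simp: transition_tree.simps[of n w] finite_pivots)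
    then show ?thesis
      using 1(1)[of c] transition_permutes[OF 1(2) False c(1)] 1(2) False
      by (simp add: finite_pivots)
  qed
qed

end

theory Submission
  imports Defs "HOL-Real_Asymp.Real_Asymp"
begin

text \<open>
  Since \<open>|S_n| = n!\<close>, it suffices to find one permutation in \<open>S_n\<close> with at least \<open>2^n * n!\<close>
  leaves; we find one with at least \<open>2^(p^2)\<close> leaves, where \<open>n\<close> is about \<open>28 p\<close>.

  Its first \<open>m\<close> rows are \<^emph>\<open>particles\<close>, located at their values. The next rows hold larger values
  in decreasing order, and the values in the remaining, increasing rows are \<^emph>\<open>holes\<close>. The transitions
  empty these large rows from the bottom up. Emptying row \<open>x\<close> is a scan of the particles from the
  highest value down: if \<open>v\<close> is the current value in row \<open>x\<close> and \<open>v - 1\<close> is a hole, then a pivot moves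
  a particle to \<open>v - 1\<close> and puts its old value into row \<open>x\<close>. The highest particle below \<open>v\<close> is
  always a pivot, and the second one is too if it lies in a later row; then the first one may be
  overtaken. Hence, with particles of two kinds, the first kind occupying the earlier rows, each row
  offers many independent choices. Each overtaking takes a hole out of a gap, so these choices are
  arranged in gadgets through which the gaps flow unchanged: over four rows, a gadget lets itself be
  overtaken by one particle in two ways, with the same result. A train of \<open>p\<close> gadgets overtaken by
  \<open>p\<close> particles gives \<open>p^2\<close> binary choices.
\<close>

section \<open>Leaves and accessible boxes\<close>

definition leaf_count :: "nat \<Rightarrow> (nat \<Rightarrow> nat) \<Rightarrow> nat" where
  "leaf_count n w = size (leaves (transition_tree n w))"

lemma leaf_count_nonvexillary:
  assumes "w permutes {1..n}" "\<not> vexillary n w"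
  shows "leaf_count n w =
    (\<Sum>c\<in>pivots w (accessible_box n w). leaf_count n (transition w (accessible_box n w) c))"
proof -
  \<comment> \<open>Without children, \<open>leaves\<close> would count the node itself as a
    leaf.\<close>
  have "mset_set (pivots w (accessible_box n w)) \<noteq> {#}"
    using pivots_nonempty[OF assms] finite_pivots by (simp add: mset_set_empty_iff)
  then show ?thesis
    using assms
    by (simp add: leaf_count_def transition_tree.simps[of n w] sum_unfold_sum_mset
        image_mset.compositionality comp_def)
qed

text \<open>For a lower bound it is enough to exhibit some of the pivots.\<close>

lemma leaf_count_ge_sum:
  assumes "w permutes {1..n}" "\<not> vexillary n w" "C \<subseteq> pivots w (accessible_box n w)"
  shows "(\<Sum>c\<in>C. leaf_count n (transition w (accessible_box n w) c)) \<le> leaf_count n w"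
  unfolding leaf_count_nonvexillary[OF assms(1,2)]
  using assms(3) finite_pivots by (intro sum_mono2) auto

lemma leaf_count_pos:
  assumes "w permutes {1..n}"
  shows "0 < leaf_count n w"
  using assms
proof (induction n w rule: transition_tree.induct)
  case (1 n w)
  show ?case
  proof (cases "vexillary n w")
    case True
    then show ?thesis by (simp add: leaf_count_def transition_tree.simps[of n w])
  next
    case False
    obtain c where c: "c \<in> pivots w (accessible_box n w)"
      using pivots_nonempty[OF 1(2) False] by blast
    have "0 < leaf_count n (transition w (accessible_box n w) c)"
      using 1(1)[of c] c transition_permutes[OF 1(2) False c] 1(2) False
      by (simp add: finite_pivots)
    moreover have "\<dots> \<le> leaf_count n w"
      using leaf_count_ge_sum[OF 1(2) False, of "{c}"] c by simp
    ultimately show ?thesis by simp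
  qed
qed

section \<open>Accessible boxes and transitions above rows whose boxes are dominant\<close>

text \<open>
  For \<open>w \<in> S_n\<close> this says that every box of the diagram below row \<open>x\<close> lies in the dominant
  component.
\<close>

definition dominant_below :: "nat \<Rightarrow> (nat \<Rightarrow> nat) \<Rightarrow> bool" where
  "dominant_below x w \<longleftrightarrow>
     (\<forall>c i i'. 1 \<le> c \<longrightarrow> c < i \<longrightarrow> i < i' \<longrightarrow> x < i \<longrightarrow> w c < w i' \<longrightarrow> w i' < w i \<longrightarrow> False)"

lemma dominant_belowD:
  assumes "dominant_below x w" "1 \<le> c" "c < i" "i < i'" "x < i" "w c < w i'"
  shows "\<not> w i' < w i"
  using assms unfolding dominant_below_def by blast

text \<open>A box outside the dominant component has an entry of \<open>w\<close> to its north-west.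
  Below row \<open>x\<close> this would give the pattern excluded by \<open>dominant_below\<close>,
  and in row \<open>x\<close> no box lies to the right of column \<open>w x - 1\<close>.\<close>

lemma accessible_box_eqI:
  assumes w: "w permutes {1..n}" and dom: "dominant_below x w" and x: "x \<le> n"
    and c: "1 \<le> c" "c < x" "w c < y" and y: "Suc y = w x" "x < inv w y"
  shows "accessible_box n w = (x, y)"
proof -
  have winv [simp]: "w (inv w j) = j" for j
    using permutes_inverses(1)[OF w] by simp
  have inv_w [simp]: "inv w (w i) = i" for i
    using permutes_inverses(2)[OF w] by simp
  have "w x \<in> {1..n}" using permutes_in_image[OF w, of x] x c by auto
  then have D: "(x, y) \<in> rothe_diagram n w"
    using x c y by (auto simp: rothe_diagram_def)
  have "(x + 1, y) \<notin> rothe_diagram n w"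
  proof
    assume "(x + 1, y) \<in> rothe_diagram n w"
    then have "y < w (x + 1)" "x + 1 < inv w y" by (auto simp: rothe_diagram_def)
    then show False
      using dominant_belowD[OF dom c(1), of "x + 1" "inv w y"] c by auto
  qed
  moreover have "(x, y + 1) \<notin> rothe_diagram n w"
    using y by (auto simp: rothe_diagram_def)
  moreover have "(x, y) \<notin> dominant_component n w"
    using dominant_component_no_NW[OF w, of "(x, y)" c] c by auto
  ultimately have ess: "(x, y) \<in> essential_set n w - dominant_component n w"
    using D by (auto simp: essential_set_def)
  have max: "i < x \<or> i = x \<and> j \<le> y"
    if "(i, j) \<in> essential_set n w - dominant_component n w" for i j
  proof -
    have ij: "(i, j) \<in> rothe_diagram n w" "(i, j) \<notin> dominant_component n w"
      using that by (auto simp: essential_set_def)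
    then have lt: "j < w i" "i < inv w j" by (auto simp: rothe_diagram_def)
    obtain d where d: "1 \<le> d" "d \<le> i" "w d \<le> j"
      using no_NW_dominant_component[OF w ij(1)] ij(2) by (meson not_le)
    have "d \<noteq> i" using d lt by auto
    moreover have "w d \<noteq> j" using d lt by auto
    ultimately have "\<not> x < i"
      using dominant_belowD[OF dom d(1), of i "inv w j"] d lt by auto
    then show ?thesis using lt y by (cases "i = x") auto
  qed
  have "is_accessible_box n w (x, y)"
    unfolding is_accessible_box_def using ess max by fastforce
  then show ?thesis
    unfolding accessible_box_def by (metis is_accessible_box_unique the_equality)
qed

text \<open>Among the rows below \<open>x\<close> only the value \<open>y\<close> changes, to
  \<open>Suc y\<close>, which keeps their relative order. So a bad pattern has its inversion already
  in \<open>w\<close>. There \<open>c\<close> completes it if \<open>w c < w i'\<close>; otherwise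
  row \<open>e\<close> has kept its value and completes it.\<close>

lemma dominant_below_transition:
  assumes w: "w permutes {1..n}" and dom: "dominant_below x w"
    and c: "1 \<le> c" "c < x" "w c < y" and y: "Suc y = w x" "x < inv w y"
  shows "dominant_below x (transition w (x, y) c)"
proof -
  define x' where "x' = inv w y"
  have wx': "w x' = y" unfolding x'_def using permutes_inverses(1)[OF w] by simp
  have x': "x < x'" using y by (simp add: x'_def)
  have inj: "w i = w j \<longleftrightarrow> i = j" for i j using permutes_inj[OF w] by (auto dest: injD)
  define w' where "w' = w(c := y, x := w c, x' := w x)"
  show ?thesis unfolding dominant_below_def
  proof (intro allI impI)
    fix e i i' assume h: "1 \<le> e" "e < i" "i < i'" "x < i"
      "transition w (x, y) c e < transition w (x, y) c i'"
      "transition w (x, y) c i' < transition w (x, y) c i"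
    have h5: "w' e < w' i'" and h6: "w' i' < w' i"
      using h(5,6) by (simp_all add: w'_def transition_def x'_def)
    have ne: "i \<noteq> c" "i \<noteq> x" "i' \<noteq> c" "i' \<noteq> x" using h c by auto
    have order: "w i' < w i"
      using h6 ne inj[of i x] inj[of i' x] inj[of i x'] inj[of i' x'] wx' y(1) h(3)
      by (auto simp: w'_def split: if_splits)
    have "w c < w i'"
    proof (cases "i' = x'")
      case True
      then show ?thesis using wx' c by simp
    next
      case False
      then have w'i': "w' i' = w i'" using ne by (simp add: w'_def)
      show ?thesis
      proof (rule ccontr)
        assume "\<not> w c < w i'"
        then have "w i' < w c" using inj[of c i'] ne by auto
        then have "w' e = w e"
          using h5 w'i' c y(1) by (auto simp: w'_def split: if_splits)
        then show False using dominant_belowD[OF dom, of e i i'] h(1-4) order h5 w'i' by auto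
      qed
    qed
    then show False using dominant_belowD[OF dom, of c i i'] order h c by auto
  qed
qed

section \<open>Processing a row\<close>

text \<open>
  A list of pairs \<open>(h, \<rho>)\<close> describes particles in order of decreasing value: \<open>\<rho>\<close> is the row, and \<open>h\<close>
  is the number of holes directly above.
\<close>

primrec placed :: "(nat \<Rightarrow> nat) \<Rightarrow> nat \<Rightarrow> (nat \<times> nat) list \<Rightarrow> bool" where
  "placed w t [] \<longleftrightarrow> True"
| "placed w t (p # ps) \<longleftrightarrow> w (snd p) + fst p + 1 = t \<and> placed w (w (snd p)) ps"

text \<open>The value from which particles listed after \<open>ps\<close> are measured.\<close>

definition level :: "(nat \<Rightarrow> nat) \<Rightarrow> nat \<Rightarrow> (nat \<times> nat) list \<Rightarrow> nat" where
  "level w t ps = (if ps = [] then t else w (snd (last ps)))"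

lemma placed_append:
  "placed w t (ps @ qs) \<longleftrightarrow> placed w t ps \<and> placed w (level w t ps) qs"
  by (induction ps arbitrary: t) (auto simp: level_def)

lemma placed_cong:
  "(\<And>\<rho>. \<rho> \<in> snd ` set ps \<Longrightarrow> w \<rho> = w' \<rho>) \<Longrightarrow> placed w t ps \<longleftrightarrow> placed w' t ps"
  by (induction ps arbitrary: t) auto

lemma level_cong:
  "(\<And>\<rho>. \<rho> \<in> snd ` set ps \<Longrightarrow> w \<rho> = w' \<rho>) \<Longrightarrow> level w t ps = level w' t ps"
  by (simp add: level_def)

lemma placed_less: "placed w t ps \<Longrightarrow> \<rho> \<in> snd ` set ps \<Longrightarrow> w \<rho> < t"
  by (induction ps arbitrary: t) fastforce+

lemma placed_level_le: "placed w t ps \<Longrightarrow> \<rho> \<in> snd ` set ps \<Longrightarrow> level w t ps \<le> w \<rho>"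
proof (induction ps arbitrary: t)
  case (Cons p ps)
  then show ?case
    using placed_less[of w "w (snd p)" ps "snd (last ps)"]
    by (cases "ps = []") (auto simp: level_def less_imp_le)
qed simp

text \<open>
  The state within the processing of row \<open>x\<close>, whose initial value was \<open>a\<close>: the particles in \<open>ds\<close> have
  been passed, those in \<open>rs\<close> are still below \<open>w x\<close>, and \<open>g\<close> is the gap that the next particle will
  have above itself. The rows \<open>m + 1, \<dots>, x - 1\<close> are spaced by 2, so that each new row comes with two
  fresh holes. Row \<open>m + 1\<close> is never processed, and the condition on the last particle keeps an
  inversion among the particles; both serve to keep a pattern 2143.
\<close>

definition chain_state ::
  "nat \<Rightarrow> nat \<Rightarrow> nat \<Rightarrow> nat \<Rightarrow> (nat \<times> nat) list \<Rightarrow> nat \<Rightarrow> (nat \<times> nat) list \<Rightarrow> (nat \<Rightarrow> nat) \<Rightarrow> bool"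
where
  "chain_state n m x a ds g rs w \<longleftrightarrow>
     w permutes {1..n} \<and> dominant_below x w \<and> m + 1 < x \<and> x \<le> n \<and> w x \<le> a \<and>
     snd ` set (ds @ rs) = {1..m} \<and> distinct (map snd (ds @ rs)) \<and> snd (last (ds @ rs)) \<noteq> 1 \<and>
     (\<forall>i. m < i \<longrightarrow> i < x \<longrightarrow> w i = a + 2 * (x - i)) \<and> (\<forall>i\<in>{1..m}. w i < a) \<and>
     (\<exists>j\<in>{x..n}. w j = a) \<and>
     placed w (a + 2) ds \<and> placed w (w x) rs \<and> w x + g = level w (a + 2) ds"

section \<open>Pattern 2143, accessible box and pivots while a row is processed\<close>

lemma chain_stateD:
  assumes "chain_state n m x a ds g rs w"
  shows chain_state_permutes: "w permutes {1..n}"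
    and chain_state_dominant: "dominant_below x w"
    and chain_state_bounds: "m + 1 < x" "x \<le> n" "w x \<le> a"
    and chain_state_rows: "snd ` set ds \<union> snd ` set rs = {1..m}"
    and chain_state_distinct: "distinct (map snd (ds @ rs))"
    and chain_state_last: "snd (last (ds @ rs)) \<noteq> 1"
    and chain_state_upper: "\<And>i. m < i \<Longrightarrow> i < x \<Longrightarrow> w i = a + 2 * (x - i)"
    and chain_state_lower: "\<And>i. i \<in> {1..m} \<Longrightarrow> w i < a"
    and chain_state_mem: "\<exists>j\<in>{x..n}. w j = a"
    and chain_state_placed: "placed w (a + 2) ds" "placed w (w x) rs"
      "w x + g = level w (a + 2) ds"
  using assms unfolding chain_state_def set_append image_Un by blast+

text \<open>Rows after \<open>m\<close> are large, and passed particles lie at level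
  \<open>w x + g\<close> or above. Hence only rows in \<open>rs\<close> can be pivots.\<close>

lemma chain_state_above:
  assumes cs: "chain_state n m x a ds g rs w" and i: "1 \<le> i" "i < x" "i \<notin> snd ` set rs"
  shows "w x \<le> w i"
proof (cases "m < i")
  case True
  then show ?thesis using chain_state_upper[OF cs True i(2)] chain_state_bounds[OF cs] by simp
next
  case False
  then have "i \<in> {1..m}" using i by simp
  then have "i \<in> snd ` set ds" using chain_state_rows[OF cs] i(3) by blast
  then show ?thesis
    using placed_level_le[OF chain_state_placed(1)[OF cs]] chain_state_placed(3)[OF cs]
    by fastforce
qed

text \<open>Rows \<open>1\<close>, \<open>c\<close>, \<open>m + 1\<close>, \<open>j\<close> form a
  pattern 2143, where \<open>c\<close> is the row of the lowest particle and \<open>j\<close> the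
  row holding \<open>a\<close>.\<close>

lemma chain_state_not_vexillary:
  assumes cs: "chain_state n m x a ds g rs w" and "rs \<noteq> []"
  shows "\<not> vexillary n w"
proof -
  define c where "c = snd (last rs)"
  have c_rs: "c \<in> snd ` set rs" using \<open>rs \<noteq> []\<close> by (simp add: c_def)
  then have c: "c \<in> {1..m}" using chain_state_rows[OF cs] by blast
  have "c \<noteq> 1" using chain_state_last[OF cs] \<open>rs \<noteq> []\<close> by (simp add: c_def)
  note placed = chain_state_placed[OF cs] and x = chain_state_bounds[OF cs]
  have less: "w c < w x" using placed_less[OF placed(2) c_rs] .
  have "w c \<le> w 1"
  proof (cases "1 \<in> snd ` set rs")
    case True
    then show ?thesis
      using placed_level_le[OF placed(2) True] \<open>rs \<noteq> []\<close> by (simp add: level_def c_def)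
  next
    case False
    then show ?thesis using less chain_state_above[OF cs _ _ False] x by simp
  qed
  moreover have "w c \<noteq> w 1"
    using \<open>c \<noteq> 1\<close> permutes_inj[OF chain_state_permutes[OF cs]] by (auto dest: injD)
  ultimately have "w c < w 1" by simp
  moreover obtain j where "x \<le> j" "j \<le> n" "w j = a" using chain_state_mem[OF cs] by auto
  moreover have "w 1 < a" using chain_state_lower[OF cs] c by simp
  moreover have "a < w (m + 1)" using chain_state_upper[OF cs, of "m + 1"] x by simp
  moreover have "1 < c" "c < m + 1" using c \<open>c \<noteq> 1\<close> by auto
  ultimately show ?thesis
    unfolding vexillary_def not_not using x(1)
    by - (rule exI[of _ 1], rule exI[of _ c], rule exI[of _ "m + 1"], rule exI[of _ j], simp)
qed

text \<open>As \<open>h > 0\<close>, the value \<open>w x - 1\<close> lies strictly between the next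
  particle and \<open>w x\<close>, hence in no row before \<open>x\<close>: it is a hole.\<close>

lemma chain_state_box:
  assumes cs: "chain_state n m x a ds g ((h, \<rho>) # rs) w" and h: "0 < h"
  defines "y \<equiv> w x - 1"
  shows "accessible_box n w = (x, y)" "x < inv w y" "Suc y = w x" "w \<rho> < y" "\<rho> \<in> {1..m}"
    "\<And>i. 1 \<le> i \<Longrightarrow> i < x \<Longrightarrow> w i < y \<Longrightarrow> w i \<le> w \<rho> \<and> i \<in> snd ` set ((h, \<rho>) # rs)"
proof -
  note w = chain_state_permutes[OF cs] and x = chain_state_bounds[OF cs]
  have \<rho>: "w \<rho> + h + 1 = w x" and pl: "placed w (w \<rho>) rs" using chain_state_placed(2)[OF cs] by auto
  then show y: "Suc y = w x" "w \<rho> < y" using h by (auto simp: y_def)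
  show \<rho>m: "\<rho> \<in> {1..m}" using chain_state_rows[OF cs] by auto
  have le: "w i \<le> w \<rho>" if "i \<in> snd ` set ((h, \<rho>) # rs)" for i
    using that less_imp_le[OF placed_less[OF pl, of i]] by force
  show mem: "w i \<le> w \<rho> \<and> i \<in> snd ` set ((h, \<rho>) # rs)" if "1 \<le> i" "i < x" "w i < y" for i
    using chain_state_above[OF cs that(1,2)] le[of i] that(3) y by linarith
  have winv: "w (inv w y) = y" using permutes_inverses(1)[OF w] by simp
  have "w x \<in> {1..n}" using permutes_in_image[OF w, of x] x by auto
  then have inv_n: "inv w y \<in> {1..n}"
    using permutes_in_image[OF permutes_inv[OF w], of y] y by auto
  have "\<not> inv w y < x"
  proof
    assume lt: "inv w y < x"
    show False
    proof (cases "inv w y \<in> snd ` set ((h, \<rho>) # rs)")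
      case True
      then show False using le[OF True] winv y by simp
    next
      case False
      then show False using chain_state_above[OF cs _ lt False] inv_n winv y by simp
    qed
  qed
  moreover have "inv w y \<noteq> x" using winv y by auto
  ultimately show inv: "x < inv w y" by simp
  show "accessible_box n w = (x, y)"
    using accessible_box_eqI[OF w chain_state_dominant[OF cs] x(2), of \<rho> y] \<rho>m x y inv by simp
qed

text \<open>The lists of particles involve only rows before \<open>x\<close>, where the transition
  agrees with \<open>w(c := w x - 1)\<close>; the placement of the new lists can be checked for this
  simpler function.\<close>

lemma chain_state_transition:
  assumes cs: "chain_state n m x a ds g ((h, \<rho>) # rs) w" and h: "0 < h"
    and c: "c \<in> pivots w (accessible_box n w)" "c \<in> {1..m}"
    and new: "snd ` set ds' \<union> snd ` set rs' = {1..m}" "distinct (map snd (ds' @ rs'))"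
      "snd (last (ds' @ rs')) \<noteq> 1"
      "placed (w(c := w x - 1)) (a + 2) ds'" "placed (w(c := w x - 1)) (w c) rs'"
      "w c + g' = level (w(c := w x - 1)) (a + 2) ds'"
  shows "chain_state n m x a ds' g' rs' (transition w (accessible_box n w) c)"
proof -
  define y where "y = w x - 1"
  note box = chain_state_box[OF cs h, folded y_def] and new' = new[folded y_def]
  have nv: "\<not> vexillary n w" using chain_state_not_vexillary[OF cs] by simp
  note w = chain_state_permutes[OF cs] and x = chain_state_bounds[OF cs]
  have c': "1 \<le> c" "c < x" "w c < y" using c(1) unfolding box(1) by (auto simp: pivots_def)
  define w' where "w' = transition w (x, y) c"
  have w'_eq: "w' = w(c := y, x := w c, inv w y := w x)" by (simp add: w'_def transition_def)
  have w': "w' permutes {1..n}" using transition_permutes[OF w nv c(1)] by (simp add: box(1) w'_def)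
  have dom': "dominant_below x w'"
    unfolding w'_def using dominant_below_transition[OF w chain_state_dominant[OF cs] c' box(3,2)] .
  have below: "w' i = (w(c := y)) i" if "i < x" for i
    using that box(2) by (auto simp: w'_eq)
  have at_x: "w' x = w c" using box(2) c' by (simp add: w'_eq)
  have rows: "i < x" if "i \<in> snd ` set ds' \<union> snd ` set rs'" for i
    using that new(1) x by simp
  have winv: "w (inv w y) = y" using permutes_inverses(1)[OF w] by simp
  obtain j where j: "j \<in> {x..n}" "w j = a" using chain_state_mem[OF cs] by auto
  \<comment> \<open>If row \<open>x\<close> holds \<open>a\<close>, the transition moves
    \<open>a\<close> to the row of the hole \<open>y\<close>; otherwise \<open>a\<close> stays where
    it is.\<close>
  have mem': "\<exists>j\<in>{x..n}. w' j = a"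
  proof (cases "j = x")
    case True
    have "w x \<in> {1..n}" using permutes_in_image[OF w, of x] x by auto
    then have "inv w y \<in> {1..n}"
      using permutes_in_image[OF permutes_inv[OF w], of y] box(3) c' by auto
    then show ?thesis
      using True j box(2) by (intro bexI[of _ "inv w y"]) (auto simp: w'_eq)
  next
    case False
    have "j \<noteq> inv w y" using j box(3) x winv by auto
    then show ?thesis
      using False j c' by (intro bexI[of _ j]) (auto simp: w'_eq)
  qed
  have placed': "placed w' (a + 2) ds'" "placed w' (w' x) rs'" "w' x + g' = level w' (a + 2) ds'"
    unfolding at_x
    using new'(4-6) below rows placed_cong[of ds' w' "w(c := y)"] placed_cong[of rs' w' "w(c := y)"]
      level_cong[of ds' w' "w(c := y)"] by simp_all
  have upper': "w' i = a + 2 * (x - i)" if "m < i" "i < x" for i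
    using below[OF that(2)] chain_state_upper[OF cs that] c(2) that by auto
  have lower': "w' i < a" if "i \<in> {1..m}" for i
    using below[of i] chain_state_lower[OF cs that] x box(3) that by auto
  have "w' x \<le> a" unfolding at_x using c' box(3) x by simp
  then have "chain_state n m x a ds' g' rs' w'"
    unfolding chain_state_def set_append image_Un
    using w' dom' x new mem' placed' upper' lower' by blast
  then show ?thesis by (simp add: box(1) w'_def)
qed

text \<open>No particle lies between \<open>w \<rho>\<close> and \<open>w x\<close>, so
  \<open>\<rho>\<close> is a pivot. It arrives \<open>g\<close> holes below the passed particles.
  The value it vacates goes to row \<open>x\<close>, and \<open>h\<close> becomes the gap for the
  next particle.\<close>

lemma chain_state_next:
  assumes cs: "chain_state n m x a ds g ((h, \<rho>) # rs) w" and h: "0 < h"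
  shows "\<rho> \<in> pivots w (accessible_box n w)"
    and "chain_state n m x a (ds @ [(g, \<rho>)]) h rs (transition w (accessible_box n w) \<rho>)"
proof -
  note box = chain_state_box[OF cs h] and placed = chain_state_placed[OF cs]
  have "\<not> w \<rho> < w i" if "\<rho> < i" "i < x" "w i < w x - 1" for i
    using box(6)[of i] that by auto
  then show piv: "\<rho> \<in> pivots w (accessible_box n w)"
    unfolding box(1) using box(4,5) chain_state_bounds(1)[OF cs] by (auto simp: pivots_def)
  have \<rho>: "w \<rho> + h + 1 = w x" "placed w (w \<rho>) rs" using placed(2) by auto
  let ?w = "w(\<rho> := w x - 1)"
  have notin: "\<rho> \<notin> snd ` set ds" "\<rho> \<notin> snd ` set rs" using chain_state_distinct[OF cs] by auto
  have eq: "w i = ?w i" if "i \<in> snd ` set ds \<or> i \<in> snd ` set rs" for i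
    using that notin by auto
  have level: "level ?w (a + 2) ds = w x + g"
    using level_cong[of ds w ?w] eq placed(3) by simp
  show "chain_state n m x a (ds @ [(g, \<rho>)]) h rs (transition w (accessible_box n w) \<rho>)"
  proof (rule chain_state_transition[OF cs h piv box(5)])
    show "placed ?w (a + 2) (ds @ [(g, \<rho>)])"
      using placed(1) placed_cong[of ds w ?w] eq level \<rho>(1) by (simp add: placed_append)
    show "placed ?w (w \<rho>) rs"
      using \<rho>(2) placed_cong[of rs w ?w] eq by simp
    show "w \<rho> + h = level ?w (a + 2) (ds @ [(g, \<rho>)])"
      using \<rho>(1) by (simp add: level_def)
    show "snd ` set (ds @ [(g, \<rho>)]) \<union> snd ` set rs = {1..m}"
      using chain_state_rows[OF cs] by simp
  qed (use chain_state_distinct[OF cs] chain_state_last[OF cs] in auto)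
qed

text \<open>Only \<open>\<rho>\<close> lies between \<open>\<rho>'\<close> and row \<open>x\<close>
  in value, and its row is earlier, so \<open>\<rho>'\<close> is a pivot as well. It takes the top
  hole of the gap above \<open>\<rho>\<close>, and its own vacated place enlarges the next gap. With
  \<open>rs\<close> empty, \<open>\<rho>\<close> would become the last particle, possibly in row
  1.\<close>

lemma chain_state_skip:
  assumes cs: "chain_state n m x a ds g ((h, \<rho>) # (h', \<rho>') # rs) w" and h: "0 < h"
    and \<rho>\<rho>': "\<rho> < \<rho>'" and rs: "rs \<noteq> []"
  shows "\<rho>' \<in> pivots w (accessible_box n w)"
    and "chain_state n m x a (ds @ [(g, \<rho>'), (h - 1, \<rho>)]) (Suc h') rs
      (transition w (accessible_box n w) \<rho>')"
proof -
  note box = chain_state_box[OF cs h] and placed = chain_state_placed[OF cs]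
  have \<rho>: "w \<rho> + h + 1 = w x" "w \<rho>' + h' + 1 = w \<rho>" "placed w (w \<rho>') rs"
    using placed(2) by auto
  have \<rho>'m: "\<rho>' \<in> {1..m}" using chain_state_rows[OF cs] by auto
  have "\<not> w \<rho>' < w i" if "\<rho>' < i" "i < x" "w i < w x - 1" for i
    using box(6)[of i] that placed_less[OF \<rho>(3), of i] \<rho>\<rho>' by auto
  then show piv: "\<rho>' \<in> pivots w (accessible_box n w)"
    unfolding box(1) using box(4) \<rho>'m \<rho> chain_state_bounds(1)[OF cs] by (auto simp: pivots_def)
  let ?w = "w(\<rho>' := w x - 1)"
  have notin: "\<rho>' \<notin> snd ` set ds" "\<rho>' \<notin> snd ` set rs" using chain_state_distinct[OF cs] by auto
  have eq: "w i = ?w i" if "i \<in> snd ` set ds \<or> i \<in> snd ` set rs" for i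
    using that notin by auto
  have level: "level ?w (a + 2) ds = w x + g"
    using level_cong[of ds w ?w] eq placed(3) by simp
  show "chain_state n m x a (ds @ [(g, \<rho>'), (h - 1, \<rho>)]) (Suc h') rs
      (transition w (accessible_box n w) \<rho>')"
  proof (rule chain_state_transition[OF cs h piv \<rho>'m])
    show "placed ?w (a + 2) (ds @ [(g, \<rho>'), (h - 1, \<rho>)])"
      using placed(1) placed_cong[of ds w ?w] eq level \<rho>(1) \<rho>\<rho>' h by (simp add: placed_append)
    show "placed ?w (w \<rho>') rs"
      using \<rho>(3) placed_cong[of rs w ?w] eq by simp
    show "w \<rho>' + Suc h' = level ?w (a + 2) (ds @ [(g, \<rho>'), (h - 1, \<rho>)])"
      using \<rho> \<rho>\<rho>' by (simp add: level_def)
    show "snd ` set (ds @ [(g, \<rho>'), (h - 1, \<rho>)]) \<union> snd ` set rs = {1..m}"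
      using chain_state_rows[OF cs] by (simp add: insert_commute)
  qed (use chain_state_distinct[OF cs] chain_state_last[OF cs] rs in auto)
qed

section \<open>Counting the effects of one row and of successive rows\<close>

text \<open>
  The boolean says whether a particle is of the second kind, that is, allowed to overtake. The
  possible effects of processing a row are computed from the gaps and the kinds alone. The last
  particle never overtakes.
\<close>

fun row_steps :: "nat \<Rightarrow> (nat \<times> bool) list \<Rightarrow> (nat \<times> bool) list list" where
  "row_steps g [] = [[]]"
| "row_steps g [(h, b)] = (if h = 0 then [] else [[(g, b)]])"
| "row_steps g ((h, b) # (h', b') # rs) =
     (if h = 0 then []
      else map ((#) (g, b)) (row_steps h ((h', b') # rs)) @
        (if \<not> b \<and> b' \<and> rs \<noteq> []
         then map (\<lambda>l. (g, b') # (h - 1, b) # l) (row_steps (Suc h') rs) else []))"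

text \<open>The incoming gap is always 2, the fresh holes that come with each row.\<close>

primrec walk_count :: "nat \<Rightarrow> (nat \<times> bool) list \<Rightarrow> nat" where
  "walk_count 0 c = 1"
| "walk_count (Suc r) c = (\<Sum>c'\<leftarrow>row_steps 2 c. walk_count r c')"

text \<open>Kinds are read off from rows by the threshold \<open>q\<close>. So a particle of the
  second kind lies in a later row than any of the first kind, as overtaking requires.\<close>

definition shape :: "nat \<Rightarrow> (nat \<times> nat) list \<Rightarrow> (nat \<times> bool) list" where
  "shape q = map (\<lambda>p. (fst p, q < snd p))"

lemma shape_simps [simp]:
  "shape q [] = []" "shape q (p # ps) = (fst p, q < snd p) # shape q ps"
  "shape q (ps @ ps') = shape q ps @ shape q ps'" "shape q ps = [] \<longleftrightarrow> ps = []"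
  by (simp_all add: shape_def)

text \<open>The two branches of \<open>row_steps\<close> belong to different pivots, so the leaf
  counts of their subtrees add up. The induction is on the number of particles left in the row;
  \<open>f\<close> bounds the leaves once the row is done.\<close>

lemma sum_row_steps_le_leaf_count:
  assumes "chain_state n m x a ds g rs w"
    and "\<And>ds' g' w'. chain_state n m x a ds' g' [] w' \<Longrightarrow> f (shape q ds') \<le> leaf_count n w'"
  shows "(\<Sum>l\<leftarrow>row_steps g (shape q rs). f (shape q ds @ l)) \<le> leaf_count n w"
  using assms(1)
proof (induction "length rs" arbitrary: ds g rs w rule: less_induct)
  case less
  show ?case
  proof (cases rs)
    case Nil
    then show ?thesis using assms(2) less(2) by simp
  next
    case (Cons p rs')
    obtain h \<rho> where p: "p = (h, \<rho>)" by force
    show ?thesis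
    \<comment> \<open>With no hole above the next particle, \<open>row_steps\<close> is empty and
      the bound is zero.\<close>
    proof (cases "h = 0")
      case True
      then show ?thesis using Cons p by (cases rs') auto
    next
      case False
      let ?b = "accessible_box n w"
      have cs: "chain_state n m x a ds g ((h, \<rho>) # rs') w" and h: "0 < h"
        using less(2) Cons p False by auto
      note w = chain_state_permutes[OF cs]
      have nv: "\<not> vexillary n w" using chain_state_not_vexillary[OF cs] by simp
      note keep = chain_state_next[OF cs h]
      have sum_keep: "(\<Sum>l\<leftarrow>row_steps h (shape q rs'). f (shape q ds @ (g, q < \<rho>) # l))
          \<le> leaf_count n (transition w ?b \<rho>)"
        using less(1)[OF _ keep(2)] Cons by simp
      have le: "leaf_count n (transition w ?b \<rho>) \<le> leaf_count n w"
        using leaf_count_ge_sum[OF w nv, of "{\<rho>}"] keep(1) by simp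
      show ?thesis
      proof (cases rs')
        case Nil
        then show ?thesis using sum_keep le Cons p False by simp
      next
        case Cons': (Cons p' rs'')
        obtain h' \<rho>' where p': "p' = (h', \<rho>')" by force
        show ?thesis
        proof (cases "\<not> q < \<rho> \<and> q < \<rho>' \<and> rs'' \<noteq> []")
          case False
          then show ?thesis
            using sum_keep le Cons Cons' p p' h by (auto simp: comp_def)
        next
          case True
          have cs': "chain_state n m x a ds g ((h, \<rho>) # (h', \<rho>') # rs'') w"
            using cs Cons' p' by simp
          note skip = chain_state_skip[OF cs' h]
          have "\<rho> < \<rho>'" "rs'' \<noteq> []" using True by auto
          note skip = skip[OF this]
          have "(\<Sum>l\<leftarrow>row_steps (Suc h') (shape q rs''). f (shape q ds @ (g, q < \<rho>') # (h - 1, q < \<rho>) # l))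
              \<le> leaf_count n (transition w ?b \<rho>')"
            using less(1)[OF _ skip(2)] Cons Cons' by simp
          moreover have "leaf_count n (transition w ?b \<rho>) + leaf_count n (transition w ?b \<rho>')
              \<le> leaf_count n w"
            using leaf_count_ge_sum[OF w nv, of "{\<rho>, \<rho>'}"] keep(1) skip(1) \<open>\<rho> < \<rho>'\<close> by simp
          ultimately show ?thesis
            using sum_keep True Cons Cons' p p' h by (simp add: comp_def)
        qed
      qed
    qed
  qed
qed

text \<open>Row \<open>x - 1\<close> holds \<open>a + 2\<close>, the value from which
  \<open>ds\<close> was measured, so the passed particles become the remaining ones. All rows before
  \<open>x\<close> now have larger values, so row \<open>x\<close> cannot be the top of a pattern
  excluded by \<open>dominant_below\<close>.\<close>

lemma chain_state_next_row:
  assumes cs: "chain_state n m x a ds g [] w" and x: "m + 1 < x - 1"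
  shows "chain_state n m (x - 1) (a + 2) [] 2 ds w"
proof -
  note x' = chain_state_bounds[OF cs] and rows = chain_state_rows[OF cs]
  have "dominant_below (x - 1) w"
    unfolding dominant_below_def
  proof (intro allI impI)
    fix c i i' assume h: "1 \<le> c" "c < i" "i < i'" "x - 1 < i" "w c < w i'" "w i' < w i"
    show False
    proof (cases "i = x")
      case True
      then show False using chain_state_above[OF cs, of c] h by simp
    next
      case False
      then have "x < i" using h(4) by linarith
      then show False using dominant_belowD[OF chain_state_dominant[OF cs] h(1-3)] h by simp
    qed
  qed
  moreover have wx: "w (x - 1) = a + 2" using chain_state_upper[OF cs, of "x - 1"] x by simp
  moreover have "w i = a + 2 + 2 * (x - 1 - i)" if "m < i" "i < x - 1" for i
    using chain_state_upper[OF cs that(1)] that by simp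
  moreover have "w i < a + 2" if "i \<in> {1..m}" for i
    using chain_state_lower[OF cs that] by simp
  moreover have "\<exists>j\<in>{x - 1..n}. w j = a + 2"
    using wx x' x by (intro bexI[of _ "x - 1"]) auto
  moreover have "placed w (w (x - 1)) ds" using chain_state_placed(1)[OF cs] wx by simp
  moreover have "w (x - 1) + 2 = level w (a + 2 + 2) []" using wx by (simp add: level_def)
  ultimately show ?thesis
    unfolding chain_state_def append_Nil
    using chain_state_permutes[OF cs] chain_state_distinct[OF cs] chain_state_last[OF cs] rows x x'
    by simp
qed

lemma walk_count_le_leaf_count:
  assumes "chain_state n m (m + 1 + r) a [] 2 rs w"
  shows "walk_count r (shape q rs) \<le> leaf_count n w"
  using assms
proof (induction r arbitrary: a rs w)
  case 0
  \<comment> \<open>Vacuous, since \<open>chain_state\<close> demands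
    \<open>m + 1 < x\<close>.\<close>
  then show ?case by (auto dest: chain_state_bounds(1))
next
  case (Suc r)
  have "walk_count r (shape q ds) \<le> leaf_count n w'"
    if cs: "chain_state n m (m + 1 + Suc r) a ds g [] w'" for ds g w'
  proof (cases "r = 0")
    case True
    \<comment> \<open>Row \<open>m + 2\<close> was the last one processed; one leaf below the state
      reached suffices.\<close>
    then show ?thesis
      using leaf_count_pos[OF chain_state_permutes[OF cs]] by (simp add: Suc_le_eq)
  next
    case False
    then show ?thesis using Suc.IH chain_state_next_row[OF cs] by simp
  qed
  from sum_row_steps_le_leaf_count[where f = "walk_count r" and q = q, OF Suc.prems this]
  show ?case by simp
qed

section \<open>Gadgets\<close>

text \<open>
  The effect of one row on a segment of the list with incoming gap \<open>g\<close> and outgoing gap \<open>e\<close>.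
\<close>

inductive segment_step ::
  "nat \<Rightarrow> (nat \<times> bool) list \<Rightarrow> nat \<Rightarrow> (nat \<times> bool) list \<Rightarrow> bool"
where
  Nil: "segment_step g [] g []"
| keep: "segment_step h A e A' \<Longrightarrow> 0 < h \<Longrightarrow> segment_step g ((h, b) # A) e ((g, b) # A')"
| swap: "segment_step (Suc h') A e A' \<Longrightarrow>
    segment_step g ((Suc h, False) # (h', True) # A) e ((g, True) # (h, False) # A')"

lemma segment_step_append:
  "segment_step g A e A' \<Longrightarrow> segment_step e B f B' \<Longrightarrow> segment_step g (A @ B) f (A' @ B')"
  by (induction rule: segment_step.induct) (auto intro: segment_step.intros)

lemma segment_step_concat:
  "(\<And>i. segment_step g (A i) g (B i)) \<Longrightarrow>
    segment_step g (concat (map A is)) g (concat (map B is))"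
  by (induction "is") (auto intro: segment_step.Nil segment_step_append)

lemma segment_step_replicate:
  "0 < g \<Longrightarrow> segment_step g (replicate i (g, b)) g (replicate i (g, b))"
  by (induction i) (auto intro: segment_step.intros)

text \<open>The extra last particle guarantees the condition \<open>rs \<noteq> []\<close> of
  \<open>row_steps\<close> at each swap, and it absorbs the outgoing gap.\<close>

lemma segment_step_row_steps:
  "segment_step g A e A' \<Longrightarrow> 0 < h \<Longrightarrow> A' @ [(e, b)] \<in> set (row_steps g (A @ [(h, b)]))"
proof (induction rule: segment_step.induct)
  case (keep h' A e A' g b')
  then show ?case by (cases "A @ [(h, b)]") auto
qed auto

lemma walk_count_ge_sum:
  assumes "finite D" "D \<subseteq> set (row_steps 2 c)"
  shows "(\<Sum>c'\<in>D. walk_count r c') \<le> walk_count (Suc r) c"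
proof -
  have "(\<Sum>c'\<in>D. walk_count r c') \<le> (\<Sum>c'\<in>set (row_steps 2 c). walk_count r c')"
    using assms by (intro sum_mono2) auto
  also have "\<dots> \<le> (\<Sum>c'\<leftarrow>xs. walk_count r c')" if "xs = row_steps 2 c" for xs
    unfolding that[symmetric]
    by (induction xs) (auto simp: sum.insert_if)
  finally show ?thesis by simp
qed

lemma walk_count_ge_segment_step:
  assumes "segment_step 2 A 2 A'"
  shows "walk_count r (A' @ [(2, True)]) \<le> walk_count (Suc r) (A @ [(2, True)])"
  using walk_count_ge_sum[of "{A' @ [(2, True)]}" "A @ [(2, True)]" r]
    segment_step_row_steps[OF assms, of 2 True] by simp

text \<open>
  Both choices of \<open>\<beta>\<close> lead from \<open>gadget @ [(2, True)]\<close> to \<open>(2, True) # gadget\<close> in four rows with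
  constant incoming and outgoing gap 2; this gadget was found by computer search.
\<close>

definition gadget :: "(nat \<times> bool) list" where
  "gadget = [(2, False), (2, True), (2, False), (1, True), (2, False)]"

text \<open>The states after one, two and three of the four rows, with the overtaking particle
  included. The two choices already differ after the first row.\<close>

definition gadget1 :: "bool \<Rightarrow> (nat \<times> bool) list" where
  "gadget1 \<beta> = (if \<beta>
     then [(2, True), (1, False), (3, True), (1, False), (2, False), (2, True)]
     else [(2, True), (1, False), (3, False), (2, True), (1, False), (2, True)])"

definition gadget2 :: "bool \<Rightarrow> (nat \<times> bool) list" where
  "gadget2 \<beta> = (if \<beta>
     then [(2, True), (2, False), (1, True), (3, False), (1, False), (2, True)]
     else [(2, True), (2, False), (1, True), (2, False), (3, False), (1, True)])"

definition gadget3 :: "bool \<Rightarrow> (nat \<times> bool) list" where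
  "gadget3 \<beta> = (if \<beta>
     then [(2, True), (2, False), (2, True), (1, False), (3, False), (1, True)]
     else [(2, True), (2, False), (2, True), (1, False), (2, True), (2, False)])"

text \<open>As rewrite rules, these equations evaluate steps between concrete segments.\<close>

lemma segment_step_code:
  "segment_step g ((h, b) # A) e ((g', b') # A') \<longleftrightarrow>
     0 < h \<and> g' = g \<and> (b' = b \<and> segment_step h A e A' \<or>
       \<not> b \<and> b' \<and> (\<exists>h' B B'. A = (h', True) # B \<and> A' = (h - 1, False) # B' \<and> segment_step (Suc h') B e B'))"
  "segment_step g [] e [] \<longleftrightarrow> g = e"
  by (subst segment_step.simps, force)+

lemma gadget_steps:
  "segment_step 2 (gadget @ [(2, True)]) 2 (gadget1 \<beta>)"
  "segment_step 2 (gadget1 \<beta>) 2 (gadget2 \<beta>)"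
  "segment_step 2 (gadget2 \<beta>) 2 (gadget3 \<beta>)"
  "segment_step 2 (gadget3 \<beta>) 2 ((2, True) # gadget)"
  by (auto simp: gadget_def gadget1_def gadget2_def gadget3_def segment_step_code)

section \<open>Trains of gadgets working in parallel\<close>

lemma inj_concat_map:
  assumes "\<And>i j. length (A i) = length (A j)" "inj A" "length is = length js"
    "concat (map A is) = concat (map A js)"
  shows "is = js"
  using assms(3,4)
  by (induction "is" js rule: list_induct2) (use assms(1,2) in \<open>auto dest: injD\<close>)

text \<open>Here \<open>j\<close> particles have left the train at the front, one sits behind each
  gadget, and \<open>i\<close> wait at the end. In four rows each gadget is overtaken by the
  particle behind it; regrouped, this is the train with \<open>j\<close> raised and \<open>i\<close>
  lowered by one.\<close>

definition train :: "nat \<Rightarrow> nat \<Rightarrow> nat \<Rightarrow> (nat \<times> bool) list" where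
  "train p j i = replicate j (2, True) @ concat (replicate p (gadget @ [(2, True)])) @
     replicate i (2, True)"

lemma train_shift:
  "concat (replicate p ((2, True) # gadget)) @ replicate (Suc i) (2, True) =
    (2, True) # concat (replicate p (gadget @ [(2, True)])) @ replicate i (2, True)"
  by (induction p) simp_all

text \<open>The gadgets choose independently. The \<open>2 ^ p\<close> choice vectors give different
  states after the first row, whose counts add up, and three further rows bring all of them to the
  same train.\<close>

lemma walk_count_train_step:
  "2 ^ p * walk_count r (train p (Suc j) i @ [(2, True)]) \<le>
     walk_count (4 + r) (train p j (Suc i) @ [(2, True)])"
proof -
  define st where "st F \<beta>s = replicate j (2, True) @ concat (map F \<beta>s) @ replicate (Suc i) (2, True)"
    for F :: "bool \<Rightarrow> (nat \<times> bool) list" and \<beta>s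
  define B where "B = {\<beta>s :: bool list. length \<beta>s = p}"
  have card_B: "card B = 2 ^ p" and fin_B: "finite B"
    using card_lists_length_eq[of "UNIV :: bool set" p] finite_lists_length_eq[of "UNIV :: bool set" p]
    by (simp_all add: B_def)
  have step: "segment_step 2 (st F \<beta>s) 2 (st F' \<beta>s)" if "\<And>\<beta>. segment_step 2 (F \<beta>) 2 (F' \<beta>)" for F F' \<beta>s
    unfolding st_def
    by (intro segment_step_append[where e = 2] segment_step_replicate segment_step_concat that) auto
  have start: "st (\<lambda>_. gadget @ [(2, True)]) \<beta>s = train p j (Suc i)"
    and final: "st (\<lambda>_. (2, True) # gadget) \<beta>s = train p (Suc j) i" if "\<beta>s \<in> B" for \<beta>s
    using that train_shift[of p i]
    by (simp_all add: st_def train_def B_def map_replicate_const replicate_append_same[symmetric])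
  \<comment> \<open>Both versions of \<open>gadget1\<close> have length 6, so the choices can be
    read off block by block.\<close>
  have inj: "inj_on (\<lambda>\<beta>s. st gadget1 \<beta>s @ [(2, True)]) B"
  proof (rule inj_onI)
    fix \<beta>s \<gamma>s assume *: "\<beta>s \<in> B" "\<gamma>s \<in> B" "st gadget1 \<beta>s @ [(2, True)] = st gadget1 \<gamma>s @ [(2, True)]"
    show "\<beta>s = \<gamma>s"
      by (rule inj_concat_map[of gadget1]) (use * in \<open>auto simp: st_def B_def gadget1_def inj_def\<close>)
  qed
  have "walk_count r (train p (Suc j) i @ [(2, True)]) \<le> walk_count (3 + r) (st gadget1 \<beta>s @ [(2, True)])"
    if "\<beta>s \<in> B" for \<beta>s
  proof -
    have "walk_count r (train p (Suc j) i @ [(2, True)]) \<le> walk_count (Suc r) (st gadget3 \<beta>s @ [(2, True)])"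
      unfolding final[OF that, symmetric] by (intro walk_count_ge_segment_step step gadget_steps)
    also have "\<dots> \<le> walk_count (Suc (Suc r)) (st gadget2 \<beta>s @ [(2, True)])"
      by (intro walk_count_ge_segment_step step gadget_steps)
    also have "\<dots> \<le> walk_count (Suc (Suc (Suc r))) (st gadget1 \<beta>s @ [(2, True)])"
      by (intro walk_count_ge_segment_step step gadget_steps)
    finally show ?thesis by (simp only: numeral_3_eq_3 add_Suc add_0)
  qed
  then have "2 ^ p * walk_count r (train p (Suc j) i @ [(2, True)]) \<le>
      (\<Sum>\<beta>s\<in>B. walk_count (3 + r) (st gadget1 \<beta>s @ [(2, True)]))"
    using sum_mono[of B "\<lambda>_. walk_count r (train p (Suc j) i @ [(2, True)])"] by (simp add: card_B)
  also have "\<dots> = (\<Sum>c\<in>(\<lambda>\<beta>s. st gadget1 \<beta>s @ [(2, True)]) ` B. walk_count (3 + r) c)"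
    by (simp add: sum.reindex[OF inj])
  also have "\<dots> \<le> walk_count (Suc (3 + r)) (train p j (Suc i) @ [(2, True)])"
  proof (rule walk_count_ge_sum)
    have "segment_step 2 (train p j (Suc i)) 2 (st gadget1 \<beta>s)" if "\<beta>s \<in> B" for \<beta>s
      unfolding start[OF that, symmetric] by (intro step gadget_steps)
    then show "(\<lambda>\<beta>s. st gadget1 \<beta>s @ [(2, True)]) ` B
        \<subseteq> set (row_steps 2 (train p j (Suc i) @ [(2, True)]))"
      using segment_step_row_steps[of 2 _ 2 _ 2 True] by auto
  qed (simp add: fin_B)
  finally show ?thesis by (simp add: numeral_eq_Suc)
qed

lemma walk_count_train: "2 ^ (p * i) \<le> walk_count (4 * i) (train p j i @ [(2, True)])"
proof (induction i arbitrary: j)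
  case (Suc i)
  have "2 ^ (p * Suc i) = (2 ^ p * 2 ^ (p * i) :: nat)" by (simp add: power_add)
  also have "\<dots> \<le> 2 ^ p * walk_count (4 * i) (train p (Suc j) i @ [(2, True)])"
    using Suc by simp
  also have "\<dots> \<le> walk_count (4 * Suc i) (train p j (Suc i) @ [(2, True)])"
    using walk_count_train_step[of p "4 * i" j i] by simp
  finally show ?case .
qed simp

section \<open>The permutation with many leaves\<close>

text \<open>Down the list, particles of the first kind receive the rows after
  \<open>q\<^sub>0\<close> in turn, and those of the second kind the rows after \<open>s\<close>.
  Both offsets vary in the induction.\<close>

lemma ex_rows_of_shape:
  assumes "q\<^sub>0 + length (filter (\<lambda>p. \<not> snd p) c) \<le> q" "q \<le> s"
  shows "\<exists>rs. shape q rs = c \<and> distinct (map snd rs) \<and>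
    snd ` set rs = {q\<^sub>0<..q\<^sub>0 + length (filter (\<lambda>p. \<not> snd p) c)} \<union> {s<..s + length (filter snd c)}"
  using assms
proof (induction c arbitrary: q\<^sub>0 s)
  case (Cons p c)
  obtain h b where p: "p = (h, b)" by force
  show ?case
  proof (cases b)
    case True
    obtain rs where rs: "shape q rs = c" "distinct (map snd rs)"
        "snd ` set rs = {q\<^sub>0<..q\<^sub>0 + length (filter (\<lambda>p. \<not> snd p) c)} \<union> {Suc s<..Suc s + length (filter snd c)}"
      using Cons.IH[of q\<^sub>0 "Suc s"] Cons.prems p True by auto
    have "Suc s \<notin> snd ` set rs" using rs(3) Cons.prems p True by auto
    moreover have "insert (Suc s) (snd ` set rs) = {q\<^sub>0<..q\<^sub>0 + length (filter (\<lambda>p. \<not> snd p) c)} \<union>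
        {s<..s + length (filter snd (p # c))}"
      unfolding rs(3) using p True by auto
    ultimately show ?thesis
      using rs(1,2) p True Cons.prems by (intro exI[of _ "(h, Suc s) # rs"]) auto
  next
    case False
    obtain rs where rs: "shape q rs = c" "distinct (map snd rs)"
        "snd ` set rs = {Suc q\<^sub>0<..Suc q\<^sub>0 + length (filter (\<lambda>p. \<not> snd p) c)} \<union> {s<..s + length (filter snd c)}"
      using Cons.IH[of "Suc q\<^sub>0" s] Cons.prems p False by auto
    have "Suc q\<^sub>0 \<notin> snd ` set rs" using rs(3) Cons.prems p False by auto
    moreover have "insert (Suc q\<^sub>0) (snd ` set rs) = {q\<^sub>0<..q\<^sub>0 + length (filter (\<lambda>p. \<not> snd p) (p # c))} \<union>
        {s<..s + length (filter snd c)}"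
      unfolding rs(3) using p False by auto
    ultimately show ?thesis
      using rs(1,2) p False Cons.prems by (intro exI[of _ "(h, Suc q\<^sub>0) # rs"]) auto
  qed
qed simp

text \<open>Values are assigned from the top down. The sum counts the values taken by particles and
  gaps, so the strict bound keeps all values positive.\<close>

lemma ex_placed:
  assumes "distinct (map snd ps)" "(\<Sum>p\<leftarrow>ps. fst p + 1) < t"
  shows "\<exists>v. placed v t ps \<and> (\<forall>\<rho>\<in>snd ` set ps. 0 < v \<rho>)"
  using assms
proof (induction ps arbitrary: t)
  case (Cons p ps)
  define t' where "t' = t - (fst p + 1)"
  have t': "t' + fst p + 1 = t" "(\<Sum>p\<leftarrow>ps. fst p + 1) < t'" using Cons.prems by (auto simp: t'_def)
  obtain v where v: "placed v t' ps" "\<forall>\<rho>\<in>snd ` set ps. 0 < v \<rho>"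
    using Cons.IH[OF _ t'(2)] Cons.prems by auto
  have eq: "v \<rho> = (v(snd p := t')) \<rho>" if "\<rho> \<in> snd ` set ps" for \<rho>
    using that Cons.prems(1) by (metis distinct.simps(2) fun_upd_other list.simps(9) set_map)
  have "placed (v(snd p := t')) t (p # ps)"
    using v(1) placed_cong[of ps v "v(snd p := t')" t', OF eq] t'(1) by simp
  moreover have "0 < (v(snd p := t')) \<rho>" if "\<rho> \<in> snd ` set (p # ps)" for \<rho>
    using that v(2) t'(2) by auto
  ultimately show ?case by blast
qed simp

lemma placed_inj_on: "placed w t ps \<Longrightarrow> inj_on w (snd ` set ps)"
proof (induction ps arbitrary: t)
  case (Cons p ps)
  then show ?case using placed_less[of w "w (snd p)" ps] by fastforce
qed simp

text \<open>The values left over are listed increasingly after row \<open>k\<close>. This makes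
  \<open>dominant_below\<close> hold at the start.\<close>

lemma ex_permutes_increasing_above:
  assumes inj: "inj_on f {1..k}" and f: "f ` {1..k} \<subseteq> {1..n::nat}"
  shows "\<exists>w. w permutes {1..n} \<and> (\<forall>i\<in>{1..k}. w i = f i) \<and> (\<forall>i j. k < i \<longrightarrow> i < j \<longrightarrow> w i < w j)"
proof -
  define S where "S = {1..n} - f ` {1..k}"
  define xs where "xs = sorted_list_of_set S"
  have kn: "k \<le> n" using card_mono[OF _ f] card_image[OF inj] by simp
  have fin: "finite S" by (simp add: S_def)
  have "card S = n - k"
    using f card_image[OF inj] by (simp add: S_def card_Diff_subset)
  then have len: "length xs = n - k" by (simp add: xs_def)
  have set: "set xs = S" using fin by (simp add: xs_def)
  have sorted: "sorted_wrt (<) xs" by (simp add: xs_def)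
  have nth_S: "xs ! (i - Suc k) \<in> S" if "k < i" "i \<le> n" for i
    using that len unfolding set[symmetric] by (intro nth_mem) auto
  define w where "w i = (if i \<in> {1..k} then f i else if i \<in> {1..n} then xs ! (i - Suc k) else i)" for i
  have low: "w i = f i" if "i \<in> {1..k}" for i using that by (simp add: w_def)
  have up: "w i = xs ! (i - Suc k)" if "k < i" "i \<le> n" for i using that by (simp add: w_def)
  have out: "w i = i" if "i \<notin> {1..n}" for i using that kn by (auto simp: w_def)
  have wS: "w i \<in> S" if "k < i" "i \<le> n" for i using nth_S up that by simp
  \<comment> \<open>Rows beyond \<open>n\<close>, where \<open>w\<close> is the identity, are
    included because \<open>dominant_below\<close> does not bound its rows.\<close>
  have mono: "w i < w j" if "k < i" "i < j" for i j
  proof (cases "j \<le> n")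
    case True
    then show ?thesis
      using sorted_wrt_nth_less[OF sorted, of "i - Suc k" "j - Suc k"] that len up by simp
  next
    case False
    then show ?thesis using that wS[of i] out[of i] out[of j] by (cases "i \<le> n") (auto simp: S_def)
  qed
  have image: "w ` {1..n} \<subseteq> {1..n}"
  proof
    fix y assume "y \<in> w ` {1..n}"
    then obtain i where i: "i \<in> {1..n}" "y = w i" by blast
    show "y \<in> {1..n}"
    proof (cases "i \<le> k")
      case True
      then have "i \<in> {1..k}" using i by simp
      then show ?thesis unfolding i(2) using low f by blast
    next
      case False
      then show ?thesis using i wS[of i] by (simp add: S_def)
    qed
  qed
  have "inj_on w {1..n}"
  proof (rule linorder_inj_onI')
    fix i j assume ij: "i \<in> {1..n}" "j \<in> {1..n}" "i < j"
    consider "j \<le> k" | "i \<le> k" "k < j" | "k < i" by linarith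
    then show "w i \<noteq> w j"
    proof cases
      case 1
      then show ?thesis using ij inj low[of i] low[of j] by (auto dest: inj_onD)
    next
      case 2
      then have "w i \<in> f ` {1..k}" using ij low[of i] by simp
      then show ?thesis using 2 ij wS[of j] by (auto simp: S_def)
    next
      case 3
      then show ?thesis using mono[of i j] ij by simp
    qed
  qed
  then have "bij_betw w {1..n} {1..n}"
    using endo_inj_surj[OF _ image] by (simp add: bij_betw_def)
  then have "w permutes {1..n}" using out by (rule bij_imp_permutes)
  then show ?thesis using low mono by blast
qed

lemma ex_chain_state:
  assumes rows: "distinct (map snd rs)" "snd ` set rs = {1..m}" "snd (last rs) \<noteq> 1"
    and a: "(\<Sum>p\<leftarrow>rs. fst p + 1) < a" and r: "0 < r" and n: "a + 2 * r \<le> n"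
  shows "\<exists>w. chain_state n m (m + 1 + r) a [] 2 rs w"
proof -
  define x where "x = m + 1 + r"
  obtain v where v: "placed v a rs" "\<forall>\<rho>\<in>{1..m}. 0 < v \<rho>"
    using ex_placed[OF rows(1) a] rows(2) by auto
  have v_less: "v i < a" if "i \<in> {1..m}" for i
    using placed_less[OF v(1)] rows(2) that by simp
  have v_inj: "inj_on v {1..m}" using placed_inj_on[OF v(1)] rows(2) by simp
  \<comment> \<open>The large rows descend from \<open>a + 2 * r\<close> in row \<open>m + 1\<close>
    to \<open>a\<close> in row \<open>x\<close>.\<close>
  define f where "f i = (if i \<le> m then v i else a + 2 * (x - i))" for i
  have "inj_on f {1..x}"
  proof (rule linorder_inj_onI')
    fix i j assume ij: "i \<in> {1..x}" "j \<in> {1..x}" "i < j"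
    consider "j \<le> m" | "i \<le> m" "m < j" | "m < i" by linarith
    then show "f i \<noteq> f j"
    proof cases
      case 1
      then show ?thesis using ij v_inj by (auto simp: f_def dest: inj_onD)
    next
      case 2
      then show ?thesis using ij v_less[of i] by (simp add: f_def)
    next
      case 3
      then show ?thesis using ij by (simp add: f_def)
    qed
  qed
  moreover have "f ` {1..x} \<subseteq> {1..n}"
  proof
    fix y assume "y \<in> f ` {1..x}"
    then obtain i where i: "i \<in> {1..x}" "y = f i" by blast
    show "y \<in> {1..n}"
    proof (cases "i \<le> m")
      case True
      then have "i \<in> {1..m}" using i by simp
      then show ?thesis using True i v_less[of i] v(2) n by (fastforce simp: f_def)
    next
      case False
      then have "x - i \<le> r" using i by (simp add: x_def)
      then have "2 * (x - i) \<le> 2 * r" by simp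
      then show ?thesis using False i a n unfolding i(2) f_def by auto
    qed
  qed
  ultimately obtain w where w: "w permutes {1..n}" "\<And>i. i \<in> {1..x} \<Longrightarrow> w i = f i"
      "\<And>i j. x < i \<Longrightarrow> i < j \<Longrightarrow> w i < w j"
    using ex_permutes_increasing_above by metis
  have wx: "w x = a" using w(2)[of x] by (simp add: f_def x_def)
  have w_v: "w i = v i" if "i \<in> {1..m}" for i using that w(2)[of i] by (simp add: f_def x_def)
  \<comment> \<open>Otherwise \<open>w\<close> would fix \<open>x\<close>, giving
    \<open>a = x > n\<close>.\<close>
  have "x \<le> n"
    using permutes_in_image[OF w(1), of x] permutes_not_in[OF w(1), of x] wx a n r
    by (cases "x \<le> n") auto
  moreover have "dominant_below x w"
    unfolding dominant_below_def using w(3) by (meson less_asym)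
  moreover have "placed w (w x) rs"
    using placed_cong[of rs w v a] w_v v(1) wx rows(2) by simp
  moreover have "w i = a + 2 * (x - i)" if "m < i" "i < x" for i
    using that w(2)[of i] by (simp add: f_def)
  moreover have "w i < a" if "i \<in> {1..m}" for i using w_v v_less that by simp
  ultimately have "chain_state n m x a [] 2 rs w"
    unfolding chain_state_def append_Nil
    using w(1) wx rows r by (auto simp: x_def level_def)
  then show ?thesis unfolding x_def by blast
qed

lemma ex_many_leaves:
  assumes p: "0 < p" and n: "28 * p + 4 \<le> n"
  shows "\<exists>w. w permutes {1..n} \<and> 2 ^ (p * p) \<le> leaf_count n w"
proof -
  define c where "c = train p 0 p @ [(2, True)]"
  \<comment> \<open>Each gadget with the particle behind it has three particles of either kind;
    \<open>p\<close> waiting particles and the final one are added.\<close>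
  have Z: "length (filter (\<lambda>p. \<not> snd p) c) = 3 * p"
    by (simp add: c_def train_def gadget_def filter_concat length_concat sum_list_replicate)
  have O: "length (filter snd c) = 4 * p + 1"
    by (simp add: c_def train_def gadget_def filter_concat length_concat sum_list_replicate)
  obtain rs where rs: "shape (3 * p) rs = c" "distinct (map snd rs)" "snd ` set rs = {1..7 * p + 1}"
  proof -
    have "{0<..0 + 3 * p} \<union> {3 * p<..3 * p + (4 * p + 1)} = {1..7 * p + 1}" by auto
    then have "\<exists>rs. shape (3 * p) rs = c \<and> distinct (map snd rs) \<and> snd ` set rs = {1..7 * p + 1}"
      using ex_rows_of_shape[of 0 c "3 * p" "3 * p"] by (simp add: Z O)
    then show ?thesis using that by blast
  qed
  have "(\<Sum>p\<leftarrow>rs. fst p + 1) = (\<Sum>p\<leftarrow>shape (3 * p) rs. fst p + 1)"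
    by (simp add: shape_def comp_def)
  also have "\<dots> = 20 * p + 3"
  proof -
    have "(\<Sum>p\<leftarrow>concat (replicate k (gadget @ [(2, True)])). fst p + 1) = 17 * k" for k
      by (induction k) (simp_all add: gadget_def)
    then show ?thesis
      unfolding rs(1) by (simp add: c_def train_def sum_list_replicate)
  qed
  finally have sum: "(\<Sum>p\<leftarrow>rs. fst p + 1) < 20 * p + 4" by simp
  have "rs \<noteq> []" using rs(1) by (auto simp: c_def)
  then have "last (shape (3 * p) rs) = (fst (last rs), 3 * p < snd (last rs))"
    by (simp add: shape_def last_map)
  then have "3 * p < snd (last rs)" unfolding rs(1) by (simp add: c_def)
  then have "snd (last rs) \<noteq> 1" using p by simp
  \<comment> \<open>There are \<open>4 * p\<close> rows to process, four for each of
    \<open>p\<close> rounds; with \<open>a = 20 * p + 4\<close> the largest value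
    \<open>a + 2 * (4 * p)\<close> is \<open>28 * p + 4\<close>.\<close>
  then obtain w where w: "chain_state n (7 * p + 1) (7 * p + 1 + 1 + 4 * p) (20 * p + 4) [] 2 rs w"
    using ex_chain_state[OF rs(2,3) _ sum, of "4 * p" n] p n by auto
  have "2 ^ (p * p) \<le> walk_count (4 * p) c"
    unfolding c_def by (rule walk_count_train)
  also have "\<dots> \<le> leaf_count n w"
    using walk_count_le_leaf_count[OF w, of "3 * p"] rs(1) by simp
  finally show ?thesis using chain_state_permutes[OF w] by blast
qed

section \<open>From one permutation to the expected number of leaves\<close>

theorem theorem1p2:
  shows "\<exists>c::real. c > 1 \<and>
    (\<lambda>n. measure_pmf.expectation (pmf_of_set {w. w permutes {1..n}})
           (\<lambda>w. real (size (leaves (transition_tree n w)))))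
      \<in> \<Omega>(\<lambda>n. c ^ n)"
proof (intro exI conjI)
  let ?E = "\<lambda>n. measure_pmf.expectation (pmf_of_set {w. w permutes {1..n}})
    (\<lambda>w. real (size (leaves (transition_tree n w))))"
  \<comment> \<open>The left side is the exponent in
    \<open>2 ^ n * n ^ n = 2 powr (n + n * log 2 n)\<close>, an upper bound for
    \<open>2 ^ n * fact n\<close>; the right side is a lower bound for \<open>p ^ 2\<close>.\<close>
  have large: "\<forall>\<^sub>F n::nat in sequentially. n + n * log 2 n \<le> (n / 28 - 2) ^ 2"
    by real_asymp
  have "\<forall>\<^sub>F n in sequentially. 2 ^ n \<le> ?E n"
    using large eventually_ge_at_top[of 100]
  proof eventually_elim
    case (elim n)
    \<comment> \<open>The largest \<open>p\<close> with \<open>28 * p + 4 \<le> n\<close>;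
      \<open>n \<ge> 100\<close> makes it positive and \<open>n / 28 - 2\<close> nonnegative, so
      that the latter can be squared.\<close>
    define p where "p = (n - 4) div 28"
    have p: "0 < p" "28 * p + 4 \<le> n" "n < 28 * p + 32" using elim(2) by (auto simp: p_def)
    have fin: "finite {w. w permutes {1..n}}" by (rule finite_permutations) simp
    have card: "card {w. w permutes {1..n}} = fact n" by (simp add: card_permutations[OF refl])
    obtain w where w: "w permutes {1..n}" "2 ^ (p * p) \<le> leaf_count n w"
      using ex_many_leaves[OF p(1,2)] by blast
    then have ne: "{w. w permutes {1..n}} \<noteq> {}" by blast
    have "real n / 28 - 2 \<le> p" using p(3) by simp
    moreover have "0 \<le> real n / 28 - 2" using elim(2) by simp
    ultimately have sq: "(real n / 28 - 2) ^ 2 \<le> real p ^ 2" by (rule power_mono)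
    have "2 ^ n * fact n \<le> 2 ^ n * (real n ^ n)"
      using fact_le_power[of n, where 'a = real] by simp
    also have "\<dots> = 2 powr (n + n * log 2 n)"
      using elim(2) by (simp add: powr_add powr_realpow mult.commute[of "real n"] powr_powr[symmetric])
    also have "\<dots> \<le> 2 powr (real p ^ 2)" using elim(1) sq by simp
    also have "\<dots> = 2 ^ (p * p)"
      by (simp add: powr_realpow[symmetric] power2_eq_square)
    also have "\<dots> \<le> real (leaf_count n w)"
      using w(2) of_nat_mono[of "2 ^ (p * p)" "leaf_count n w", where 'a = real] by simp
    also have "\<dots> \<le> (\<Sum>w | w permutes {1..n}. real (leaf_count n w))"
      using w(1) fin by (intro member_le_sum) auto
    finally have "2 ^ n \<le> (\<Sum>w | w permutes {1..n}. real (leaf_count n w)) / fact n"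
      by (simp add: field_simps)
    also have "\<dots> = ?E n"
      unfolding integral_pmf_of_set[OF ne fin] card leaf_count_def by simp
    finally show ?case .
  qed
  then have "\<forall>\<^sub>F n in sequentially. 1 * norm ((2::real) ^ n) \<le> norm (?E n)"
    by (rule eventually_mono) (simp add: order_trans[OF _ abs_ge_self])
  then show "?E \<in> \<Omega>(\<lambda>n. 2 ^ n)"
    by (rule landau_omega.bigI[rotated]) simp
qed simp

end
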